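(* Let $\mathbb{B}_0=(X_1,X_2,X_3)$ be the basis of the Lie algebra of $\widetilde{\mathrm{E}_0}(2)$ with $[X_1,X_2]=X_3$, $[X_1,X_3]=-X_2$, $[X_2,X_3]=0$. Let $u>0$ and consider the left invariant metric on $\widetilde{\mathrm{E}_0}(2)$ with matrix in $\mathbb{B}_0$ $$\begin{pmatrix}0&1&0\\1&0&0\\0&0&u\end{pmatrix}.$$ Its Ricci curvature and scalar curvature are $$M(\mathrm{ric},\mathbb{B}_0)=\begin{pmatrix}1&\frac u2&0\\ \frac u2&0&0\\0&0&-\frac{u^2}2\end{pmatrix},\qquad\mathfrak{s}=\frac u2.$$ The Ricci operator is of type $\{ab2\}$ and the signature of $\mathrm{ric}$ is $(+,-,-)$.
   Context: $\widetilde{\mathrm{E}_0}(2)$ is the universal covering group of the connected component of the Euclidean group of the plane. A left invariant metric on a Lie group with Lie algebra $\mathfrak{g}$ is identified with a nondegenerate symmetric bilinear form $\langle\,,\rangle$ on $\mathfrak{g}$. The Levi-Civita product $\mathrm{L}:\mathfrak{g}\times\mathfrak{g}\to\mathfrak{g}$ is given by $2\langle\mathrm{L}_uv,w\rangle=\langle[u,v],w\rangle+\langle[w,u],v\rangle+\langle[w,v],u\rangle$, the curvature by $\mathrm{K}(u,v)=\mathrm{L}_{[u,v]}-[\mathrm{L}_u,\mathrm{L}_v]$, the Ricci tensor by $\mathrm{ric}(u,v)=\mathrm{tr}(w\mapsto\mathrm{K}(u,w)v)$, the Ricci operator by $\langle\mathrm{Ric}(u),v\rangle=\mathrm{ric}(u,v)$,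 and the scalar curvature by $\mathfrak{s}=\mathrm{tr}(\mathrm{Ric})$. $M(\mathrm{ric},\mathbb{B}_0)$ is the Gram matrix of $\mathrm{ric}$ in $\mathbb{B}_0$. The signature of $\mathrm{ric}$ is its signature as a symmetric bilinear form (signs listed in any order). A symmetric endomorphism of a three dimensional Lorentzian vector space is of type $\{ab2\}$ if its Jordan form consists of a $1\times1$ block with real eigenvalue and a $2\times2$ Jordan block with real eigenvalue. *)

theory Defs
  imports "HOL-Analysis.Analysis" "Jordan_Normal_Form.Jordan_Normal_Form"
begin

text \<open>
  The group. A Euclidean motion of the plane is written in homogeneous coordinates, that is, as
  a real 3x3 matrix that maps the plane of all x with third coordinate 1 isometrically to itself
  (this forces the last row to be (0,0,1)).
\<close>

definition euclidean_group_2 :: "(real^3^3) set" where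
  "euclidean_group_2 =
     {A. \<forall>x y. vec_nth x 3 = 1 \<and> vec_nth y 3 = 1 \<longrightarrow>
           vec_nth (A *v x) 3 = 1 \<and> dist (A *v x) (A *v y) = dist x y}"

definition euclidean_group_2_0 :: "(real^3^3) set" where
  "euclidean_group_2_0 = connected_component_set euclidean_group_2 (Finite_Cartesian_Product.mat 1)"

text \<open>For a closed matrix group, this is its Lie algebra (with the commutator as bracket).\<close>

definition tangent_at_one :: "(real^'n^'n) set \<Rightarrow> (real^'n^'n) set" where
  "tangent_at_one G =
     {A. \<exists>\<gamma>::real \<Rightarrow> real^'n^'n. \<gamma> 0 = Finite_Cartesian_Product.mat 1 \<and> (\<forall>t. \<gamma> t \<in> G) \<and>
           (\<gamma> has_vector_derivative A) (at 0)}"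

text \<open>
  The real vector space carrying the bracket br is the Lie algebra of the closed matrix group G,
  up to isomorphism. A covering homomorphism induces an isomorphism of Lie algebras, so this also
  describes the Lie algebras of the covering groups of G, in particular of its universal covering.
\<close>

definition is_lie_algebra_of ::
  "('a::real_vector \<Rightarrow> 'a \<Rightarrow> 'a) \<Rightarrow> (real^'n^'n) set \<Rightarrow> bool" where
  "is_lie_algebra_of br G \<longleftrightarrow>
     (\<exists>\<phi>. linear \<phi> \<and> bij_betw \<phi> UNIV (tangent_at_one G) \<and>
          (\<forall>x y. \<phi> (br x y) = \<phi> x ** \<phi> y - \<phi> y ** \<phi> x))"

definition ordered_basis :: "'a::real_vector list \<Rightarrow> bool" where
  "ordered_basis Xs \<longleftrightarrow> distinct Xs \<and> independent (set Xs) \<and> span (set Xs) = UNIV"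

definition gram_matrix :: "('a \<Rightarrow> 'a \<Rightarrow> real) \<Rightarrow> 'a list \<Rightarrow> real mat" where
  "gram_matrix b Xs = Matrix.mat (length Xs) (length Xs) (\<lambda>(i, j). b (Xs ! i) (Xs ! j))"

definition endo_matrix :: "('a::real_vector \<Rightarrow> 'a) \<Rightarrow> 'a list \<Rightarrow> real mat" where
  "endo_matrix f Xs =
     Matrix.mat (length Xs) (length Xs)
       (\<lambda>(i, j). representation (set Xs) (f (Xs ! j)) (Xs ! i))"

text \<open>
  The trace of an endomorphism of a finite-dimensional space; it does not depend on the basis B.
\<close>

definition endo_trace :: "('a::real_vector \<Rightarrow> 'a) \<Rightarrow> real" where
  "endo_trace f =
     (let B = (SOME B. independent B \<and> span B = UNIV)
      in \<Sum>b\<in>B. representation B (f b) b)"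

definition symmetric_form :: "('a::real_vector \<Rightarrow> 'a \<Rightarrow> real) \<Rightarrow> bool" where
  "symmetric_form b \<longleftrightarrow> bilinear b \<and> (\<forall>x y. b x y = b y x)"

text \<open>
  The multiset S of signs (1, -1, or 0 in degenerate directions) is the signature of b; by
  Sylvester's law of inertia it does not depend on the orthogonal basis B.
\<close>

definition has_signature :: "('a::real_vector \<Rightarrow> 'a \<Rightarrow> real) \<Rightarrow> real multiset \<Rightarrow> bool" where
  "has_signature b S \<longleftrightarrow> symmetric_form b \<and>
     (\<exists>B. finite B \<and> independent B \<and> span B = UNIV \<and>
          (\<forall>x\<in>B. \<forall>y\<in>B. x \<noteq> y \<longrightarrow> b x y = 0) \<and>
          image_mset (\<lambda>x. sgn (b x x)) (mset_set B) = S)"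

text \<open>A left invariant metric is identified with its value on the Lie algebra.\<close>

definition left_invariant_metric :: "('a::real_vector \<Rightarrow> 'a \<Rightarrow> real) \<Rightarrow> bool" where
  "left_invariant_metric g \<longleftrightarrow>
     symmetric_form g \<and> (\<forall>x. (\<forall>y. g x y = 0) \<longrightarrow> x = 0)"

context
  fixes br :: "'a::real_vector \<Rightarrow> 'a \<Rightarrow> 'a" and g :: "'a \<Rightarrow> 'a \<Rightarrow> real"
begin

definition levi_civita :: "'a \<Rightarrow> 'a \<Rightarrow> 'a" where
  "levi_civita u v =
     (THE z. \<forall>w. 2 * g z w = g (br u v) w + g (br w u) v + g (br w v) u)"

definition curvature :: "'a \<Rightarrow> 'a \<Rightarrow> 'a \<Rightarrow> 'a" where
  "curvature u v w =
     levi_civita (br u v) w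
       - (levi_civita u (levi_civita v w) - levi_civita v (levi_civita u w))"

definition ric :: "'a \<Rightarrow> 'a \<Rightarrow> real" where
  "ric u v = endo_trace (\<lambda>w. curvature u w v)"

definition ricci_operator :: "'a \<Rightarrow> 'a" where
  "ricci_operator u = (THE z. \<forall>v. g z v = ric u v)"

definition scalar_curvature :: real where
  "scalar_curvature = endo_trace ricci_operator"

end

text \<open>
  Type {ab2} for an endomorphism f of a three-dimensional Lorentzian vector space with metric g.
  The two eigenvalues a and b are allowed to coincide.
\<close>

definition type_ab2 :: "('a::real_vector \<Rightarrow> 'a \<Rightarrow> real) \<Rightarrow> ('a \<Rightarrow> 'a) \<Rightarrow> bool" where
  "type_ab2 g f \<longleftrightarrow>
     has_signature g {#1, 1, -1#} \<and>
     linear f \<and> (\<forall>x y. g (f x) y = g x (f y)) \<and>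
     (\<exists>Xs a b. ordered_basis Xs \<and> jordan_nf (endo_matrix f Xs) [(1, a), (2, b)])"

end

theory Submission
  imports Defs
begin

text \<open>
  An isomorphism with a matrix Lie algebra only serves to make the bracket bilinear and
  skew-symmetric; the three structure equations then determine it. In coordinates with respect
  to the given basis, Koszul's formula yields the Levi-Civita product, and tracing the curvature
  gives ric. With s = u / 2 the Ricci operator maps X1 to s X1 + X2, X2 to s X2 and X3 to
  - s X3, so its matrix in the reversed basis (X3, X2, X1) is already in Jordan form.
  The signatures of the metric and of ric are read off from the orthogonal bases
  (X1 + X2, X3, X1 - X2) and (X1, X2 - s X1, X3).
\<close>

section \<open>Trace, signature and duality\<close>

text \<open>Both sides equal one double sum, pairing the \<open>C\<close>-coordinates of each
  \<open>b\<close> with the \<open>B\<close>-coordinates of each \<open>f c\<close>. This is tr(PQ)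
  = tr(QP) written without matrices.\<close>

lemma sum_representation_basis_change:
  fixes f :: "'a::real_vector \<Rightarrow> 'a"
  assumes "linear f"
    and B: "independent B" "span B = UNIV" "finite B"
    and C: "independent C" "span C = UNIV" "finite C"
  shows "(\<Sum>b\<in>B. representation B (f b) b) = (\<Sum>c\<in>C. representation C (f c) c)"
proof -
  have linear_rep: "linear (\<lambda>v. representation D v x)"
    if "independent D" "span D = UNIV" for D :: "'a set" and x
    using that by (intro linearI) (auto simp: representation_add representation_scale)
  have lB: "linear (\<lambda>v. representation B v x)" and lC: "linear (\<lambda>v. representation C v x)" for x
    using linear_rep B C by auto
  have expand: "f b = (\<Sum>c\<in>C. representation C b c *\<^sub>R f c)" for b
  proof -
    have "f b = f (\<Sum>c\<in>C. representation C b c *\<^sub>R c)"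
      using C by (subst sum_representation_eq) auto
    then show ?thesis
      by (simp add: linear_sum[OF \<open>linear f\<close>] linear_scale[OF \<open>linear f\<close>])
  qed
  have "(\<Sum>b\<in>B. representation B (f b) b)
      = (\<Sum>b\<in>B. \<Sum>c\<in>C. representation C b c * representation B (f c) b)"
    by (subst expand) (simp add: linear_sum[OF lB] linear_scale[OF lB])
  also have "\<dots> = (\<Sum>c\<in>C. \<Sum>b\<in>B. representation C b c * representation B (f c) b)"
    by (rule sum.swap)
  also have "\<dots> = (\<Sum>c\<in>C. representation C (\<Sum>b\<in>B. representation B (f c) b *\<^sub>R b) c)"
    by (simp add: linear_sum[OF lC] linear_scale[OF lC] mult.commute)
  also have "\<dots> = (\<Sum>c\<in>C. representation C (f c) c)"
    using B by (subst sum_representation_eq) auto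
  finally show ?thesis .
qed

lemma endo_trace_eq:
  fixes f :: "'a::real_vector \<Rightarrow> 'a"
  assumes "linear f" and C: "independent C" "span C = UNIV" "finite C"
  shows "endo_trace f = (\<Sum>c\<in>C. representation C (f c) c)"
proof -
  define B where "B = (SOME B::'a set. independent B \<and> span B = UNIV)"
  have B: "independent B \<and> span B = UNIV"
    unfolding B_def by (rule someI[where x = C]) (use C in auto)
  \<comment> \<open>The basis picked by \<open>SOME\<close> is only known to be independent and
    spanning; lying in the span of the finite set \<open>C\<close> makes it finite.\<close>
  moreover have "finite B"
    using independent_span_bound[of C B] B C by auto
  ultimately show ?thesis
    unfolding endo_trace_def Let_def B_def[symmetric]
    using assms by (intro sum_representation_basis_change) auto
qed

lemma symmetric_form_linear:
  "symmetric_form b \<Longrightarrow> linear (b x)" "symmetric_form b \<Longrightarrow> linear (\<lambda>x. b x y)"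
  by (auto simp: symmetric_form_def bilinear_def)

text \<open>Pairing a vanishing combination with a member \<open>x\<close> of \<open>B\<close>
  leaves only the term \<open>c x * b x x\<close>. The form may be indefinite, so
  \<open>b x x\<close> being nonzero is a separate condition.\<close>

lemma orthogonal_nonnull_independent:
  fixes b :: "'a::real_vector \<Rightarrow> 'a \<Rightarrow> real"
  assumes b: "symmetric_form b" and "finite B"
    and orth: "\<forall>x\<in>B. \<forall>y\<in>B. x \<noteq> y \<longrightarrow> b x y = 0"
    and nonnull: "\<forall>x\<in>B. b x x \<noteq> 0"
  shows "independent B"
proof (rule independent_if_scalars_zero[OF \<open>finite B\<close>])
  fix c x
  assume "(\<Sum>y\<in>B. c y *\<^sub>R y) = 0" and "x \<in> B"
  then have "0 = b x (\<Sum>y\<in>B. c y *\<^sub>R y)"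
    using linear_0[OF symmetric_form_linear(1)[OF b]] by simp
  also have "\<dots> = (\<Sum>y\<in>B. c y * b x y)"
    by (simp add: linear_sum[OF symmetric_form_linear(1)[OF b]]
        linear_scale[OF symmetric_form_linear(1)[OF b]])
  also have "\<dots> = (\<Sum>y\<in>B. if y = x then c x * b x x else 0)"
    using orth \<open>x \<in> B\<close> by (intro sum.cong) auto
  also have "\<dots> = c x * b x x"
    using \<open>finite B\<close> \<open>x \<in> B\<close> by simp
  finally show "c x = 0"
    using nonnull \<open>x \<in> B\<close> by auto
qed

lemma has_signature_three:
  fixes b :: "'a::real_vector \<Rightarrow> 'a \<Rightarrow> real"
  assumes b: "symmetric_form b"
    and orth: "b x y = 0" "b x z = 0" "b y z = 0"
    and nonnull: "b x x \<noteq> 0" "b y y \<noteq> 0" "b z z \<noteq> 0"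
    and span: "span {x, y, z} = UNIV"
  shows "has_signature b {#sgn (b x x), sgn (b y y), sgn (b z z)#}"
proof -
  have sym: "b v w = b w v" for v w
    using b by (simp add: symmetric_form_def)
  \<comment> \<open>If two of the vectors coincided, orthogonality would make that vector null.
    Distinctness keeps all three signs in the multiset built from the set.\<close>
  have distinct: "x \<noteq> y" "x \<noteq> z" "y \<noteq> z"
    using orth nonnull by auto
  have orthB: "\<forall>v\<in>{x, y, z}. \<forall>w\<in>{x, y, z}. v \<noteq> w \<longrightarrow> b v w = 0"
    using orth sym by auto
  have "independent {x, y, z}"
    using b orthB nonnull by (intro orthogonal_nonnull_independent[of b]) auto
  moreover have "image_mset (\<lambda>v. sgn (b v v)) (mset_set {x, y, z})
      = {#sgn (b x x), sgn (b y y), sgn (b z z)#}"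
    using distinct by simp
  ultimately show ?thesis
    unfolding has_signature_def using b span orthB
    by (intro conjI exI[of _ "{x, y, z}"]) simp_all
qed

text \<open>Nondegeneracy makes the vector representing a functional unique, so a definition by
  \<open>THE\<close> is evaluated by exhibiting a candidate.\<close>

lemma the_dual_vector:
  assumes "left_invariant_metric g" and "\<forall>w. g z w = h w"
  shows "(THE z. \<forall>w. g z w = h w) = z"
proof (rule the_equality)
  fix z' assume "\<forall>w. g z' w = h w"
  have g: "linear (\<lambda>x. g x w)" for w
    using assms(1) symmetric_form_linear(2) by (auto simp: left_invariant_metric_def)
  have "\<forall>w. g (z' - z) w = 0"
    using assms(2) \<open>\<forall>w. g z' w = h w\<close> by (simp add: linear_diff[OF g])
  then have "z' - z = 0"
    using assms(1) unfolding left_invariant_metric_def by blast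
  then show "z' = z" by simp
qed (use assms in simp)

lemma levi_civita_eqI:
  assumes "left_invariant_metric g"
    and "\<And>w. 2 * g z w = g (br x y) w + g (br w x) y + g (br w y) x"
  shows "levi_civita br g x y = z"
proof -
  define h where "h w = g (br x y) w + g (br w x) y + g (br w y) x" for w
  \<comment> \<open>The factor 2 of Koszul's formula moves to the right, giving the predicate the
    shape treated by \<open>the_dual_vector\<close>.\<close>
  have "(\<lambda>z. \<forall>w. 2 * g z w = h w) = (\<lambda>z. \<forall>w. g z w = h w / 2)"
    by (auto simp: fun_eq_iff field_simps)
  moreover have "\<forall>w. g z w = h w / 2"
    using assms(2) by (simp add: h_def field_simps)
  ultimately show ?thesis
    unfolding levi_civita_def h_def[symmetric]
    using the_dual_vector[OF assms(1), of z "\<lambda>w. h w / 2"] by metis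
qed

text \<open>The commutator of matrices is bilinear and skew-symmetric, and the injective linear map
  \<open>\<phi>\<close> reflects these identities back to \<open>br\<close>.\<close>

lemma lie_bracket:
  fixes br :: "'a::real_vector \<Rightarrow> 'a \<Rightarrow> 'a" and G :: "(real^'n^'n) set"
  assumes "is_lie_algebra_of br G"
  shows lie_bracket_bilinear: "bilinear br" and lie_bracket_skew: "br x y = - br y x"
proof -
  obtain \<phi> :: "'a \<Rightarrow> real^'n^'n" where \<phi>: "linear \<phi>" "inj \<phi>"
    and br: "\<And>x y. \<phi> (br x y) = \<phi> x ** \<phi> y - \<phi> y ** \<phi> x"
    using assms unfolding is_lie_algebra_of_def bij_betw_def by blast
  have distrib: "(A + B) ** C = A ** C + B ** C" "C ** (A + B) = C ** A + C ** B"
    for A B C :: "real^'n^'n"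
    by (simp_all add: matrix_matrix_mult_def Finite_Cartesian_Product.vec_eq_iff algebra_simps sum.distrib)
  have "\<phi> (br (x + y) z) = \<phi> (br x z + br y z)" "\<phi> (br x (y + z)) = \<phi> (br x y + br x z)"
    "\<phi> (br (c *\<^sub>R x) y) = \<phi> (c *\<^sub>R br x y)" "\<phi> (br x (c *\<^sub>R y)) = \<phi> (c *\<^sub>R br x y)" for x y z c
    by (simp_all add: br linear_add[OF \<phi>(1)] linear_scale[OF \<phi>(1)] distrib
        scaleR_diff_right matrix_scalar_ac
        flip: scalar_matrix_assoc)
  then show "bilinear br"
    by (auto simp: bilinear_def linear_iff inj_eq[OF \<phi>(2)])
  have "\<phi> (br x y) = \<phi> (- br y x)"
    by (simp add: br linear_neg[OF \<phi>(1)])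
  then show "br x y = - br y x"
    by (simp add: inj_eq[OF \<phi>(2)])
qed

section \<open>The metric on the Lie algebra\<close>

text \<open>The group is replaced by the two properties of the bracket that it supplies. The null
  plane is the derived algebra, spanned by \<open>X2\<close> and \<open>X3\<close>: the metric is
  degenerate on it, with \<open>X2\<close> in the radical.\<close>

locale e2_null_plane_metric =
  fixes br :: "'a::real_vector \<Rightarrow> 'a \<Rightarrow> 'a"
    and X1 X2 X3 :: 'a
    and g :: "'a \<Rightarrow> 'a \<Rightarrow> real"
    and u :: real
  assumes bilinear_br: "bilinear br"
    and skew: "\<And>x y. br x y = - br y x"
    and basis: "ordered_basis [X1, X2, X3]"
    and brackets: "br X1 X2 = X3" "br X1 X3 = - X2" "br X2 X3 = 0"
    and u_pos: "u > 0"
    and metric: "left_invariant_metric g"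
    and gram: "gram_matrix g [X1, X2, X3] =
           mat_of_rows_list 3 [[0, 1, 0], [1, 0, 0], [0, 0, u]]"
begin

section \<open>Coordinates in the given basis\<close>

definition comb :: "real \<Rightarrow> real \<Rightarrow> real \<Rightarrow> 'a" where
  "comb a b c = a *\<^sub>R X1 + b *\<^sub>R X2 + c *\<^sub>R X3"

lemma basis_facts:
  shows distinct: "X1 \<noteq> X2" "X1 \<noteq> X3" "X2 \<noteq> X3"
    and indep: "independent {X1, X2, X3}" and span: "span {X1, X2, X3} = UNIV"
  using basis by (auto simp: ordered_basis_def)

lemma comb_basis: "comb 1 0 0 = X1" "comb 0 1 0 = X2" "comb 0 0 1 = X3"
  by (simp_all add: comb_def)

lemma comb_add: "comb a b c + comb a' b' c' = comb (a + a') (b + b') (c + c')"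
  and comb_diff: "comb a b c - comb a' b' c' = comb (a - a') (b - b') (c - c')"
  and comb_minus: "- comb a b c = comb (- a) (- b) (- c)"
  and comb_scale: "r *\<^sub>R comb a b c = comb (r * a) (r * b) (r * c)"
  by (simp_all add: comb_def algebra_simps)

lemmas comb_simps = comb_add comb_diff comb_minus comb_scale

lemma linear_comb: "linear f \<Longrightarrow> f (comb a b c) = a *\<^sub>R f X1 + b *\<^sub>R f X2 + c *\<^sub>R f X3"
  by (simp add: comb_def linear_add linear_scale)

lemma comb_exhaust:
  obtains a b c where "v = comb a b c"
proof
  have "v = (\<Sum>x\<in>{X1, X2, X3}. representation {X1, X2, X3} v x *\<^sub>R x)"
    using indep span by (subst sum_representation_eq) auto
  then show "v = comb (representation {X1, X2, X3} v X1) (representation {X1, X2, X3} v X2)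
      (representation {X1, X2, X3} v X3)"
    using distinct by (simp add: comb_def add.assoc)
qed

lemma representation_comb:
  "representation {X1, X2, X3} (comb a b c) X1 = a"
  "representation {X1, X2, X3} (comb a b c) X2 = b"
  "representation {X1, X2, X3} (comb a b c) X3 = c"
  using distinct indep span
  by (simp_all add: comb_def representation_add representation_scale representation_basis)

text \<open>Writing the basis vectors as \<open>comb 1 0 0\<close> and so on lets the coordinate
  formulas rewrite the premises directly.\<close>

lemma endo_trace_comb:
  assumes "linear f" "f (comb 1 0 0) = comb a1 b1 c1" "f (comb 0 1 0) = comb a2 b2 c2"
    "f (comb 0 0 1) = comb a3 b3 c3"
  shows "endo_trace f = a1 + b2 + c3"
  using endo_trace_eq[OF assms(1) indep span] distinct assms(2-)
  by (simp add: comb_basis representation_comb)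

lemma bracket_comb:
  "br (comb a b c) (comb a' b' c') = comb 0 (c * a' - a * c') (a * b' - b * a')"
proof -
  have "br x x = 0" for x
    using skew[of x x] by (metis add.right_inverse scaleR_half_double scaleR_zero_right)
  moreover have "br X2 X1 = - X3" "br X3 X1 = X2" "br X3 X2 = 0"
    using skew[of X2 X1] skew[of X3 X1] skew[of X3 X2] by (simp_all add: brackets)
  moreover have br_linear: "linear (br x)" "linear (\<lambda>x. br x y)" for x y
    using bilinear_br by (auto simp: bilinear_def)
  ultimately show ?thesis
    by (simp add: linear_comb[OF br_linear(1)] linear_comb[OF br_linear(2)] brackets)
      (simp add: comb_def algebra_simps)
qed

lemma metric_symmetric: "symmetric_form g"
  using metric by (simp add: left_invariant_metric_def)

lemma metric_comb: "g (comb a b c) (comb a' b' c') = a * b' + b * a' + u * c * c'"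
proof -
  have entry: "g ([X1, X2, X3] ! i) ([X1, X2, X3] ! j)
      = [[0, 1, 0], [1, 0, 0], [0, 0, u]] ! i ! j" if "i < 3" "j < 3" for i j
    using arg_cong[OF gram, of "\<lambda>A. A $$ (i, j)"] that
    by (simp add: gram_matrix_def mat_of_rows_list_def)
  have "g X1 X1 = 0" "g X1 X2 = 1" "g X1 X3 = 0" "g X2 X1 = 1" "g X2 X2 = 0" "g X2 X3 = 0"
    "g X3 X1 = 0" "g X3 X2 = 0" "g X3 X3 = u"
    using entry[of 0 0] entry[of 0 1] entry[of 0 2] entry[of 1 0] entry[of 1 1] entry[of 1 2]
      entry[of 2 0] entry[of 2 1] entry[of 2 2] by simp_all
  then show ?thesis
    by (simp add: linear_comb[OF symmetric_form_linear(1)[OF metric_symmetric]]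
        linear_comb[OF symmetric_form_linear(2)[OF metric_symmetric]])
qed

section \<open>Levi-Civita product and Ricci curvature\<close>

lemma levi_civita_comb:
  "levi_civita br g (comb a b c) (comb a' b' c') =
     comb (- (u / 2) * (a * c' + c * a')) (u / 2 * (b * c' + c * b') - a * c')
       (a * a' / u + (a * b' - b * a') / 2)"
\<comment> \<open>The coefficients solve Koszul's formula for \<open>w\<close> equal to
  \<open>X2\<close>, \<open>X1\<close> and \<open>X3\<close> in turn: pairing a vector with these
  returns its first coordinate, its second, and \<open>u\<close> times its third.\<close>
proof (rule levi_civita_eqI[OF metric])
  fix w
  obtain p q r where "w = comb p q r" by (rule comb_exhaust)
  then show "2 * g (comb (- (u / 2) * (a * c' + c * a')) (u / 2 * (b * c' + c * b') - a * c')
       (a * a' / u + (a * b' - b * a') / 2)) w =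
     g (br (comb a b c) (comb a' b' c')) w + g (br w (comb a b c)) (comb a' b' c') +
     g (br w (comb a' b' c')) (comb a b c)"
    using u_pos by (simp add: bracket_comb metric_comb field_simps)
qed

text \<open>The product is defined by a description, so bilinearity is read off from its coordinate
  formula.\<close>

lemma bilinear_levi_civita: "bilinear (levi_civita br g)"
proof -
  have "levi_civita br g (x + y) z = levi_civita br g x z + levi_civita br g y z"
    "levi_civita br g x (y + z) = levi_civita br g x y + levi_civita br g x z"
    "levi_civita br g (t *\<^sub>R x) y = t *\<^sub>R levi_civita br g x y"
    "levi_civita br g x (t *\<^sub>R y) = t *\<^sub>R levi_civita br g x y" for x y z t
    by (rule comb_exhaust[of x]; rule comb_exhaust[of y]; rule comb_exhaust[of z];
        simp add: levi_civita_comb comb_simps; simp add: algebra_simps add_divide_distrib diff_divide_distrib)+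
  then show ?thesis
    by (auto simp: bilinear_def linear_iff)
qed

lemma linear_curvature: "linear (\<lambda>y. curvature br g x y z)"
  by (intro linearI)
    (simp_all add: curvature_def bilinear_ladd[OF bilinear_levi_civita]
      bilinear_radd[OF bilinear_levi_civita] bilinear_lmul[OF bilinear_levi_civita]
      bilinear_rmul[OF bilinear_levi_civita] bilinear_radd[OF bilinear_br]
      bilinear_rmul[OF bilinear_br] algebra_simps)

lemma ric_comb:
  "ric br g (comb a b c) (comb a' b' c') =
     a * a' + u / 2 * (a * b' + b * a') - u\<^sup>2 / 2 * (c * c')"
  unfolding ric_def
  \<comment> \<open>The coefficients in the premises of \<open>endo_trace_comb\<close> are
    schematic; reducing the curvature of the basis vectors to a single \<open>comb\<close>
    instantiates them.\<close>
  by (subst endo_trace_comb[OF linear_curvature],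
      (simp only: curvature_def bracket_comb levi_civita_comb comb_simps)+)
    (use u_pos in \<open>simp add: field_simps power2_eq_square\<close>)

lemma symmetric_form_ric: "symmetric_form (ric br g)"
proof -
  have "ric br g (x + y) z = ric br g x z + ric br g y z"
    "ric br g x (y + z) = ric br g x y + ric br g x z"
    "ric br g (t *\<^sub>R x) y = t * ric br g x y"
    "ric br g x (t *\<^sub>R y) = t * ric br g x y"
    "ric br g x y = ric br g y x" for x y z t
    by (rule comb_exhaust[of x]; rule comb_exhaust[of y]; rule comb_exhaust[of z];
        simp add: ric_comb comb_simps; simp add: algebra_simps add_divide_distrib diff_divide_distrib)+
  then show ?thesis
    by (auto simp: symmetric_form_def bilinear_def linear_iff)
qed

section \<open>Ricci operator and scalar curvature\<close>

lemma ricci_operator_comb: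
  "ricci_operator br g (comb a b c) = comb (u / 2 * a) (a + u / 2 * b) (- (u / 2) * c)"
  unfolding ricci_operator_def
\<comment> \<open>The inverse metric swaps the first two entries of a covector and divides the third
  by \<open>u\<close>; applied to \<open>ric\<close> with fixed first argument it produces this
  vector.\<close>
proof (rule the_dual_vector[OF metric], rule allI)
  fix w
  obtain p q r where "w = comb p q r" by (rule comb_exhaust)
  then show "g (comb (u / 2 * a) (a + u / 2 * b) (- (u / 2) * c)) w = ric br g (comb a b c) w"
    by (simp add: metric_comb ric_comb field_simps power2_eq_square)
qed

lemma linear_ricci_operator: "linear (ricci_operator br g)"
proof (rule linearI)
  fix x y t
  show "ricci_operator br g (x + y) = ricci_operator br g x + ricci_operator br g y"
    "ricci_operator br g (t *\<^sub>R x) = t *\<^sub>R ricci_operator br g x"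
    by (rule comb_exhaust[of x]; rule comb_exhaust[of y];
        simp add: ricci_operator_comb comb_simps;
        simp add: algebra_simps add_divide_distrib)+
qed

lemma ricci_operator_self_adjoint: "g (ricci_operator br g x) y = g x (ricci_operator br g y)"
  by (rule comb_exhaust[of x]; rule comb_exhaust[of y];
      simp add: ricci_operator_comb metric_comb field_simps)

lemma scalar_curvature_eq: "scalar_curvature br g = u / 2"
proof -
  have "endo_trace (ricci_operator br g) = u / 2 + u / 2 + (- (u / 2))"
    by (rule endo_trace_comb[OF linear_ricci_operator])
      (simp_all only: ricci_operator_comb, simp_all)
  then show ?thesis by (simp add: scalar_curvature_def)
qed

section \<open>Signatures and Jordan type\<close>

lemma span_eq_UNIV_if_basis_in_span:
  assumes "X1 \<in> span S" "X2 \<in> span S" "X3 \<in> span S"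
  shows "span S = UNIV"
  using span_mono[of "{X1, X2, X3}" "span S"] assms span by (simp add: span_span) blast

lemma signature_metric: "has_signature g {#1, 1, -1#}"
proof -
  \<comment> \<open>\<open>X1\<close> and \<open>X2\<close> are null with product 1, so their sum
    and difference are orthogonal with squares 2 and -2.\<close>
  let ?B = "{comb 1 1 0, comb 0 0 1, comb 1 (- 1) 0}"
  have in_span: "v \<in> span ?B" if "v \<in> ?B" for v
    using that by (rule span_base)
  have "X1 = (1 / 2) *\<^sub>R comb 1 1 0 + (1 / 2) *\<^sub>R comb 1 (- 1) 0"
    "X2 = (1 / 2) *\<^sub>R comb 1 1 0 - (1 / 2) *\<^sub>R comb 1 (- 1) 0"
    "X3 = comb 0 0 1"
    by (simp_all add: comb_simps) (simp_all add: comb_def)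
  then have "span ?B = UNIV"
    using in_span by (intro span_eq_UNIV_if_basis_in_span) (metis insertCI span_add span_diff span_scale)+
  then have "has_signature g {#sgn (g (comb 1 1 0) (comb 1 1 0)), sgn (g (comb 0 0 1) (comb 0 0 1)),
      sgn (g (comb 1 (- 1) 0) (comb 1 (- 1) 0))#}"
    using u_pos by (intro has_signature_three metric_symmetric) (simp_all add: metric_comb)
  then show ?thesis
    using u_pos by (simp add: metric_comb)
qed

lemma signature_ric: "has_signature (ric br g) {#1, -1, -1#}"
proof -
  \<comment> \<open>Gram-Schmidt for \<open>ric\<close>: as \<open>X1\<close> has square 1 and
    product \<open>u / 2\<close> with \<open>X2\<close>, subtracting \<open>u / 2\<close> times
    \<open>X1\<close> from \<open>X2\<close> makes it orthogonal to \<open>X1\<close>.\<close>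
  let ?B = "{comb 1 0 0, comb (- (u / 2)) 1 0, comb 0 0 1}"
  have in_span: "v \<in> span ?B" if "v \<in> ?B" for v
    using that by (rule span_base)
  have "X1 = comb 1 0 0" "X2 = comb (- (u / 2)) 1 0 + (u / 2) *\<^sub>R comb 1 0 0" "X3 = comb 0 0 1"
    by (simp_all add: comb_simps) (simp_all add: comb_def)
  then have "span ?B = UNIV"
    using in_span by (intro span_eq_UNIV_if_basis_in_span) (metis insertCI span_add span_scale)+
  moreover have ric_values: "ric br g (comb 1 0 0) (comb 1 0 0) = 1"
    "ric br g (comb (- (u / 2)) 1 0) (comb (- (u / 2)) 1 0) = - (u\<^sup>2 / 4)"
    "ric br g (comb 0 0 1) (comb 0 0 1) = - (u\<^sup>2 / 2)"
    by (simp_all add: ric_comb field_simps power2_eq_square)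
  ultimately have "has_signature (ric br g) {#sgn (ric br g (comb 1 0 0) (comb 1 0 0)),
      sgn (ric br g (comb (- (u / 2)) 1 0) (comb (- (u / 2)) 1 0)),
      sgn (ric br g (comb 0 0 1) (comb 0 0 1))#}"
    using u_pos by (intro has_signature_three symmetric_form_ric; simp add: ric_comb)
  then show ?thesis
    using u_pos by (simp add: ric_values)
qed

lemma type_ab2_ricci_operator: "type_ab2 g (ricci_operator br g)"
proof -
  \<comment> \<open>\<open>representation\<close> depends on the basis only as a set, so
    \<open>representation_comb\<close> still applies to the reversed list.\<close>
  have perm: "set [X3, X2, X1] = {X1, X2, X3}"
    by auto
  have "ordered_basis [X3, X2, X1]"
    unfolding ordered_basis_def perm using distinct indep span by auto
  \<comment> \<open>\<open>jordan_block\<close> has its ones above the diagonal and columns hold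
    images, so the eigenvector \<open>X2\<close> must precede \<open>X1\<close>, whose image
    contains \<open>X2\<close> with coefficient 1.\<close>
  moreover have "endo_matrix (ricci_operator br g) [X3, X2, X1]
      = jordan_matrix [(1, - (u / 2)), (2, u / 2)]"
  proof (rule eq_matI)
    fix i j
    assume "i < dim_row (jordan_matrix [(1, - (u / 2)), (2, u / 2)])"
      and "j < dim_col (jordan_matrix [(1, - (u / 2)), (2, u / 2)])"
    then have ij: "i = 0 \<or> i = 1 \<or> i = 2" "j = 0 \<or> j = 1 \<or> j = 2"
      by (auto simp: jordan_matrix_def)
    have R: "ricci_operator br g X1 = comb (u / 2) 1 0" "ricci_operator br g X2 = comb 0 (u / 2) 0"
      "ricci_operator br g X3 = comb 0 0 (- (u / 2))"
      using ricci_operator_comb[of 1 0 0] ricci_operator_comb[of 0 1 0] ricci_operator_comb[of 0 0 1]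
      by (simp_all add: comb_basis)
    from ij show "endo_matrix (ricci_operator br g) [X3, X2, X1] $$ (i, j)
        = jordan_matrix [(1, - (u / 2)), (2, u / 2)] $$ (i, j)"
      unfolding endo_matrix_def perm
      by (elim disjE)
        (simp_all add: R representation_comb jordan_matrix_def jordan_block_def Let_def)
  qed (simp_all add: endo_matrix_def jordan_matrix_def)
  moreover have "jordan_nf (jordan_matrix [(1, - (u / 2)), (2, u / 2)])
      [(1, - (u / 2)), (2, u / 2)]"
    using similar_mat_refl[OF jordan_matrix_carrier] by (simp add: jordan_nf_def del: One_nat_def)
  ultimately have "\<exists>Xs a b. ordered_basis Xs \<and>
      jordan_nf (endo_matrix (ricci_operator br g) Xs) [(1, a), (2, b)]"
    by (intro exI[of _ "[X3, X2, X1]"] exI[of _ "- (u / 2)"] exI[of _ "u / 2"] conjI) simp_all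
  then show ?thesis
    using signature_metric linear_ricci_operator ricci_operator_self_adjoint
    by (simp add: type_ab2_def)
qed

lemma gram_matrix_ric:
  "gram_matrix (ric br g) [X1, X2, X3] =
     mat_of_rows_list 3 [[1, u / 2, 0], [u / 2, 0, 0], [0, 0, - (u\<^sup>2 / 2)]]"
proof (rule eq_matI)
  have R: "ric br g X1 X1 = 1" "ric br g X1 X2 = u / 2" "ric br g X1 X3 = 0"
    "ric br g X2 X1 = u / 2" "ric br g X2 X2 = 0" "ric br g X2 X3 = 0"
    "ric br g X3 X1 = 0" "ric br g X3 X2 = 0" "ric br g X3 X3 = - (u\<^sup>2 / 2)"
    using ric_comb[of 1 0 0 1 0 0] ric_comb[of 1 0 0 0 1 0] ric_comb[of 1 0 0 0 0 1]
      ric_comb[of 0 1 0 1 0 0] ric_comb[of 0 1 0 0 1 0] ric_comb[of 0 1 0 0 0 1]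
      ric_comb[of 0 0 1 1 0 0] ric_comb[of 0 0 1 0 1 0] ric_comb[of 0 0 1 0 0 1]
    by (simp_all add: comb_basis)
  fix i j
  assume "i < dim_row (mat_of_rows_list 3 [[1, u / 2, 0], [u / 2, 0, 0], [0, 0, - (u\<^sup>2 / 2)]])"
    and "j < dim_col (mat_of_rows_list 3 [[1, u / 2, 0], [u / 2, 0, 0], [0, 0, - (u\<^sup>2 / 2)]])"
  then have "i = 0 \<or> i = 1 \<or> i = 2" "j = 0 \<or> j = 1 \<or> j = 2"
    by (auto simp: mat_of_rows_list_def)
  then show "gram_matrix (ric br g) [X1, X2, X3] $$ (i, j) =
     mat_of_rows_list 3 [[1, u / 2, 0], [u / 2, 0, 0], [0, 0, - (u\<^sup>2 / 2)]] $$ (i, j)"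
    by (elim disjE) (simp_all add: R gram_matrix_def mat_of_rows_list_def)
qed (simp_all add: gram_matrix_def mat_of_rows_list_def)

end

theorem proposition4p19:
  fixes br :: "'a::real_vector \<Rightarrow> 'a \<Rightarrow> 'a"
    and X1 X2 X3 :: 'a
    and g :: "'a \<Rightarrow> 'a \<Rightarrow> real"
    and u :: real
  assumes "is_lie_algebra_of br euclidean_group_2_0"
    and "ordered_basis [X1, X2, X3]"
    and "br X1 X2 = X3" and "br X1 X3 = - X2" and "br X2 X3 = 0"
    and "u > 0"
    and "left_invariant_metric g"
    and "gram_matrix g [X1, X2, X3] =
           mat_of_rows_list 3
             [[0, 1, 0],
              [1, 0, 0],
              [0, 0, u]]"
  shows "gram_matrix (ric br g) [X1, X2, X3] =
           mat_of_rows_list 3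
             [[1,     u / 2, 0],
              [u / 2, 0,     0],
              [0,     0,     - (u\<^sup>2 / 2)]]
       \<and> scalar_curvature br g = u / 2
       \<and> type_ab2 g (ricci_operator br g)
       \<and> has_signature (ric br g) {#1, -1, -1#}"
proof -
  \<comment> \<open>The hypothesis on the group enters here, through
    \<open>lie_bracket\<close>.\<close>
  interpret e2_null_plane_metric br X1 X2 X3 g u
    by unfold_locales (fact assms lie_bracket[OF assms(1)])+
  show ?thesis
    using gram_matrix_ric scalar_curvature_eq type_ab2_ricci_operator signature_ric by blast
qed

end
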